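(* Let $\lambda=(\lambda_1\ge\dots\ge\lambda_d\ge 1)$ be a partition with $d$ parts and let $\mu$ be a partition with $[\mu]\subseteq[\lambda]$. Let $\mathrm{OOT}(\lambda/\mu)$ be the number of nonzero terms of the Okounkov--Olshanski formula of the shape $\lambda/\mu$, i.e. the number of $T\in \mathrm{SSYT}(\mu,d)$ with $\prod_{u\in[\mu]}\bigl(\lambda_{d+1-T(u)}-c(u)\bigr)\neq 0$. Then $$\mathrm{OOT}(\lambda/\mu)=\det\left[\binom{\lambda_i-\mu_j+j-1}{i-1}\right]_{i,j=1}^{d}=\det\left[\binom{\lambda'_i}{\mu'_j+i-j}\right]_{i,j=1}^{\mu_1}.$$
   Context: $[\lambda]$ is the Young diagram of $\lambda$ (English convention, cell $(i,j)$ in row $i$, column $j$), $\lambda'$ is the conjugate partition, and $\mu_j=0$ for $j>\ell(\mu)$. The content of $u=(i,j)$ is $c(u)=j-i$. $\mathrm{SSYT}(\mu,d)$ is the set of semistandard Young tableaux of shape $\mu$ (positive integer entries, rows weakly increasing, columns strictly increasing) with all entries at most $d$. The Okounkov--Olshanski formula is $f^{\lambda/\mu}=\frac{|\lambda/\mu|!}{\prod_{u\in[\lambda]}h(u)}\sum_{T\in \mathrm{SSYT}(\mu,d)}\prod_{u\in[\mu]}(\lambda_{d+1-T(u)}-c(u))$, where $f^{\lambda/\mu}$ is the number of standard Young tableaux of shape $\lambda/\mu$ and $h(u)$ is the hook length of $u$ in $\lambda$. Binomial convention: $\binom{n}{k}=0$ whenever $n<0$, $k<0$ or $k>n$. A $0\times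 0$ determinant equals $1$. *)

theory Defs
  imports "Jordan_Normal_Form.Determinant"
begin

definition is_partition :: "nat list \<Rightarrow> bool" where
  "is_partition lam \<longleftrightarrow> sorted_wrt (\<ge>) lam \<and> (\<forall>x \<in> set lam. x \<ge> 1)"

text \<open>Parts, rows, columns and tableau entries are all numbered from 1;
  \<open>part lam i\<close> is 0 for \<open>i\<close> beyond the number of parts.\<close>

definition part :: "nat list \<Rightarrow> nat \<Rightarrow> nat" where
  "part lam i = (if 1 \<le> i \<and> i \<le> length lam then lam ! (i - 1) else 0)"

definition young_diagram :: "nat list \<Rightarrow> (nat \<times> nat) set" where
  "young_diagram lam = {(i, j). 1 \<le> i \<and> i \<le> length lam \<and> 1 \<le> j \<and> j \<le> part lam i}"

text \<open>The \<open>j\<close>-th part of the conjugate partition is the length of column \<open>j\<close>,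
  hence 0 beyond the last column.\<close>

definition conj_part :: "nat list \<Rightarrow> nat \<Rightarrow> nat" where
  "conj_part lam j = card {i. (i, j) \<in> young_diagram lam}"

definition cell_content :: "nat \<times> nat \<Rightarrow> int" where
  "cell_content u = int (snd u) - int (fst u)"

text \<open>A tableau is a function on cells, extensional outside the diagram, so that distinct
  functions are distinct tableaux.\<close>

definition SSYT :: "nat list \<Rightarrow> nat \<Rightarrow> (nat \<times> nat \<Rightarrow> nat) set" where
  "SSYT mu d = {T \<in> young_diagram mu \<rightarrow>\<^sub>E {1..d}.
     (\<forall>i j j'. (i, j) \<in> young_diagram mu \<and> (i, j') \<in> young_diagram mu \<and> j < j'
        \<longrightarrow> T (i, j) \<le> T (i, j')) \<and>
     (\<forall>i i' j. (i, j) \<in> young_diagram mu \<and> (i', j) \<in> young_diagram mu \<and> i < i'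
        \<longrightarrow> T (i, j) < T (i', j))}"

text \<open>The summand indexed by \<open>T\<close> in the Okounkov--Olshanski formula, with \<open>d\<close> the number of
  parts of \<open>lam\<close>. The index \<open>d + 1 - T u\<close> is not truncated, since \<open>T u \<le> d\<close> on tableaux.\<close>

definition oo_term :: "nat list \<Rightarrow> nat list \<Rightarrow> (nat \<times> nat \<Rightarrow> nat) \<Rightarrow> int" where
  "oo_term lam mu T =
     (\<Prod>u \<in> young_diagram mu. int (part lam (length lam + 1 - T u)) - cell_content u)"

definition OOT :: "nat list \<Rightarrow> nat list \<Rightarrow> nat" where
  "OOT lam mu = card {T \<in> SSYT mu (length lam). oo_term lam mu T \<noteq> 0}"

text \<open>Binomial coefficient of integers that vanishes outside \<open>0 \<le> k \<le> n\<close>. It differs from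
  \<open>gbinomial\<close> for negative \<open>n\<close>.\<close>

definition ibinom :: "int \<Rightarrow> int \<Rightarrow> int" where
  "ibinom n k = (if n < 0 \<or> k < 0 \<or> k > n then 0 else int (nat n choose nat k))"

text \<open>The \<open>n \<times> n\<close> matrix \<open>[a i j]\<close> with \<open>i\<close> and \<open>j\<close> running over \<open>1, \<dots>, n\<close>; the library's
  matrices are indexed from 0.\<close>

definition mat1 :: "nat \<Rightarrow> (nat \<Rightarrow> nat \<Rightarrow> int) \<Rightarrow> int mat" where
  "mat1 n a = mat n n (\<lambda>(i, j). a (i + 1) (j + 1))"

end

theory Submission
  imports Defs
begin

text \<open>
  Two observations reduce the theorem to a count that can be done letter by letter.

  A factor \<open>\<lambda>\<^bsub>d+1-T(u)\<^esub> - c(u)\<close> can fall by at most 1 from one cell of a row to the next, and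
  starts positive; so a term without a zero factor has only positive factors, and this amounts to
  the flag condition \<open>j \<le> \<lambda>\<^bsub>d+1-T(i,j)\<^esub>\<close> on all cells (lemma \<open>nonzero_oo_terms\<close>). In terms of
  the conjugate partition it says that the entries of column \<open>j\<close> are among the last \<open>\<lambda>'\<^sub>j\<close> letters.

  In a tableau with this condition the largest letter \<open>d\<close> has the flag \<open>\<lambda>\<^sub>1\<close> and the other letters
  have the flags given by \<open>(\<lambda>\<^sub>2, \<dots>, \<lambda>\<^sub>d)\<close>. Removing the cells that contain \<open>d\<close>, which form
  a horizontal strip, thus gives a recursion on \<open>\<lambda>\<close>: the count for \<open>\<lambda>\<close> and a shape inside the
  first \<open>\<lambda>\<^sub>1\<close> columns is the sum of the counts for \<open>(\<lambda>\<^sub>2, \<dots>, \<lambda>\<^sub>d)\<close> over all shapes that remain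
  after the removal of a horizontal strip (lemma \<open>card_flagged_Cons\<close>).

  Each determinant satisfies the same recursion, for one of two descriptions of these shapes.
  By rows, the remaining shapes are the \<open>\<nu>\<close> with \<open>\<mu>\<^bsub>i+1\<^esub> \<le> \<nu>\<^sub>i \<le> \<mu>\<^sub>i\<close>. The first matrix has
  first row \<open>(1, \<dots>, 1)\<close>, so its determinant is that of the differences of adjacent columns below
  the first row; every difference of binomials telescopes into a sum over exactly these \<open>\<nu>\<^sub>i\<close>, and
  multilinearity in the columns gives the sum over \<open>\<nu>\<close>. By columns, the remaining shapes are
  obtained by shortening some of the columns by one cell. In the second matrix Pascal's rule writes
  column \<open>j\<close> as the sum of the columns for the lengths \<open>\<mu>'\<^sub>j\<close> and \<open>\<mu>'\<^sub>j - 1\<close>; again the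
  determinant expands by multilinearity, and a choice of lengths that is not a partition contributes
  a determinant with two equal columns or with a zero column.
\<close>

section \<open>Determinants of matrices indexed from 1\<close>

lemma mat1_carrier [simp]: "mat1 n a \<in> carrier_mat n n"
  by (simp add: mat1_def)

lemma mat1_cong:
  assumes "\<And>i j. 1 \<le> i \<Longrightarrow> i \<le> n \<Longrightarrow> 1 \<le> j \<Longrightarrow> j \<le> n \<Longrightarrow> a i j = b i j"
  shows "mat1 n a = mat1 n b"
  unfolding mat1_def by (rule eq_matI) (auto intro!: assms)

lemma det_mat1_leibniz:
  "det (mat1 n a) =
     (\<Sum>p | p permutes {0..<n}. signof p * (\<Prod>j = 1..n. a (p (j - 1) + 1) j))"
proof -
  have "det (mat1 n a) =
      (\<Sum>p | p permutes {0..<n}. signof p * (\<Prod>j<n. mat1 n a $$ (p j, j)))"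
    by (rule det_col) simp
  also have "\<dots> =
      (\<Sum>p | p permutes {0..<n}. signof p * (\<Prod>j = 1..n. a (p (j - 1) + 1) j))"
  proof (rule sum.cong[OF refl])
    fix p assume p: "p \<in> {p. p permutes {0..<n}}"
    have "(\<Prod>j<n. mat1 n a $$ (p j, j)) = (\<Prod>j<n. a (p j + 1) (j + 1))"
    proof (rule prod.cong[OF refl])
      fix j assume "j \<in> {..<n}"
      moreover have "p j < n" using p permutes_in_image[of p "{0..<n}" j] \<open>j \<in> {..<n}\<close> by auto
      ultimately show "mat1 n a $$ (p j, j) = a (p j + 1) (j + 1)"
        by (simp add: mat1_def)
    qed
    then show "signof p * (\<Prod>j<n. mat1 n a $$ (p j, j)) =
        signof p * (\<Prod>j = 1..n. a (p (j - 1) + 1) j)"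
      by (simp add: prod.atLeast1_atMost_eq)
  qed
  finally show ?thesis .
qed

lemma det_mat1_column_sums:
  assumes "\<And>j. finite (S j)"
  shows "det (mat1 n (\<lambda>i j. \<Sum>x\<in>S j. F i j x)) =
    (\<Sum>f\<in>Pi\<^sub>E {1..n} S. det (mat1 n (\<lambda>i j. F i j (f j))))"
  unfolding det_mat1_leibniz
  by (subst sum.swap) (simp add: prod_sum_PiE assms sum_distrib_left)

lemma det_mat1_zero_column:
  assumes "1 \<le> k" "k \<le> n" "\<And>i. 1 \<le> i \<Longrightarrow> i \<le> n \<Longrightarrow> a i k = 0"
  shows "det (mat1 n a) = 0"
proof -
  have "det (mat1 n a) =
      (\<Sum>i<n. mat1 n a $$ (i, k - 1) * cofactor (mat1 n a) i (k - 1))"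
    by (rule laplace_expansion_column[of _ n]) (use assms in auto)
  also have "\<dots> = 0"
    by (rule sum.neutral) (use assms in \<open>auto simp: mat1_def\<close>)
  finally show ?thesis .
qed

lemma det_mat1_equal_columns:
  assumes "1 \<le> k" "k < l" "l \<le> n" "\<And>i. 1 \<le> i \<Longrightarrow> i \<le> n \<Longrightarrow> a i k = a i l"
  shows "det (mat1 n a) = 0"
  by (rule det_identical_columns[of _ n "k - 1" "l - 1"])
     (use assms in \<open>auto simp: mat1_def intro!: eq_vecI\<close>)

lemma det_mat1_last_row:
  assumes "\<And>j. 1 \<le> j \<Longrightarrow> j \<le> n \<Longrightarrow> a (Suc n) j = 0"
  shows "det (mat1 (Suc n) a) = a (Suc n) (Suc n) * det (mat1 n a)"
proof -
  let ?A = "mat1 (Suc n) a"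
  have "det ?A = (\<Sum>j<Suc n. ?A $$ (n, j) * cofactor ?A n j)"
    by (rule laplace_expansion_row[of _ "Suc n"]) auto
  also have "\<dots> = ?A $$ (n, n) * cofactor ?A n n"
    using assms by (simp add: mat1_def)
  also have "mat_delete ?A n n = mat1 n a"
    by (rule eq_matI) (auto simp: mat_delete_def mat1_def)
  then have "cofactor ?A n n = det (mat1 n a)"
    by (simp add: cofactor_def)
  finally show ?thesis by (simp add: mat1_def)
qed

text \<open>Subtracting from each column its left neighbour, that is, multiplying by a unipotent
  bidiagonal matrix, turns the first row into \<open>(1, 0, \<dots>, 0)\<close>.\<close>

lemma det_mat1_column_differences:
  assumes "\<And>j. 1 \<le> j \<Longrightarrow> j \<le> Suc n \<Longrightarrow> a 1 j = 1"
  shows "det (mat1 (Suc n) a) = det (mat1 n (\<lambda>i j. a (i + 1) (j + 1) - a (i + 1) j))"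
proof -
  let ?N = "Suc n"
  let ?A = "mat1 ?N a"
  define U :: "int mat" where
    "U = mat ?N ?N (\<lambda>(k, j). if k = j then 1 else if Suc k = j then - 1 else 0)"
  define B where
    "B = mat ?N ?N (\<lambda>(i, j). if j = 0 then a (i + 1) 1 else a (i + 1) (j + 1) - a (i + 1) j)"
  have U: "U \<in> carrier_mat ?N ?N" and B: "B \<in> carrier_mat ?N ?N"
    by (simp_all add: U_def B_def)
  have "?A * U = B"
  proof (rule eq_matI)
    fix i j assume "i < dim_row B" "j < dim_col B"
    then have ij: "i < ?N" "j < ?N" by (auto simp: B_def)
    have "(?A * U) $$ (i, j) =
        (\<Sum>k = 0..<?N. a (i + 1) (k + 1) * (if k = j then 1 else if Suc k = j then - 1 else 0))"
      using ij U by (simp add: scalar_prod_def mat1_def U_def del: sum.op_ivl_Suc)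
    also have "\<dots> = (\<Sum>k = 0..<?N. (if k = j then a (i + 1) (k + 1) else 0) -
        (if k = j - 1 then if j = 0 then 0 else a (i + 1) (k + 1) else 0))"
      by (rule sum.cong) auto
    also have "\<dots> = B $$ (i, j)"
      using ij by (simp add: sum_subtractf B_def del: sum.op_ivl_Suc)
    finally show "(?A * U) $$ (i, j) = B $$ (i, j)" .
  qed (auto simp: B_def U_def mat1_def)
  moreover have "det U = 1"
  proof -
    have "det U = prod_list (diag_mat U)"
      by (rule det_upper_triangular[OF _ U]) (auto simp: U_def upper_triangular_def)
    also have "diag_mat U = map (\<lambda>_. 1) [0..<?N]"
      by (auto simp: diag_mat_def U_def)
    also have "prod_list \<dots> = 1" by (simp only: map_replicate_const) simp
    finally show ?thesis .
  qed
  ultimately have "det ?A = det B"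
    using det_mult[of ?A ?N U] U by simp
  also have "\<dots> = (\<Sum>j<?N. B $$ (0, j) * cofactor B 0 j)"
    by (rule laplace_expansion_row[OF B]) simp
  also have "\<dots> = (\<Sum>j<?N. if j = 0 then cofactor B 0 0 else 0)"
    using assms[of 1] assms by (intro sum.cong) (auto simp: B_def)
  also have "\<dots> = cofactor B 0 0" by (simp del: sum.lessThan_Suc)
  also have "mat_delete B 0 0 = mat1 n (\<lambda>i j. a (i + 1) (j + 1) - a (i + 1) j)"
    by (rule eq_matI) (auto simp: mat_delete_def mat1_def B_def)
  then have "cofactor B 0 0 = det (mat1 n (\<lambda>i j. a (i + 1) (j + 1) - a (i + 1) j))"
    by (simp add: cofactor_def)
  finally show ?thesis .
qed

section \<open>Binomial coefficients\<close>

lemma ibinom_of_nat: "ibinom (int n) (int k) = int (n choose k)"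
  by (auto simp: ibinom_def binomial_eq_0)

lemma ibinom_pascal:
  assumes "m \<ge> 0"
  shows "ibinom (m + 1) k = ibinom m k + ibinom m (k - 1)"
proof (cases "k \<ge> 1")
  case True
  obtain m' where m: "m = int m'" using assms by (rule nonneg_int_cases)
  obtain k' where "k - 1 = int k'" using True by (metis nonneg_int_cases diff_ge_0_iff_ge)
  then have k: "k = int (Suc k')" by simp
  have "m + 1 = int (Suc m')" "k - 1 = int k'" by (simp_all add: m k)
  then show ?thesis by (simp only: m k ibinom_of_nat) simp
next
  case False
  then show ?thesis using assms by (auto simp: ibinom_def)
qed

text \<open>For \<open>k \<ge> 1\<close> Pascal's rule also holds where the convention sets \<open>ibinom m k\<close> to 0 for
  negative \<open>m\<close>; for \<open>m = -1\<close> and \<open>k = 0\<close> it would fail. The column differences below the first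
  row of the first matrix have \<open>k \<ge> 1\<close>.\<close>

lemma ibinom_pascal_pos:
  assumes "k \<ge> 1"
  shows "ibinom (m + 1) k = ibinom m k + ibinom m (k - 1)"
proof (cases "m \<ge> 0")
  case True
  then show ?thesis by (rule ibinom_pascal)
next
  case False
  then show ?thesis using assms by (auto simp: ibinom_def)
qed

lemma ibinom_zero_top: "ibinom 0 k = (if k = 0 then 1 else 0)"
  by (auto simp: ibinom_def)

lemma ibinom_difference:
  assumes "k \<ge> 1" "b \<le> a"
  shows "ibinom (x - int b) k - ibinom (x - int a - 1) k =
    (\<Sum>v = b..a. ibinom (x - int v - 1) (k - 1))"
  using assms(2)
proof (induction a rule: dec_induct)
  case base
  show ?case using ibinom_pascal_pos[OF assms(1), of "x - int b - 1"] by simp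
next
  case (step a)
  then show ?case using ibinom_pascal_pos[OF assms(1), of "x - int a - 2"]
    by (simp add: algebra_simps)
qed

section \<open>Tableaux with flagged letters and the removal of the largest letter\<close>

text \<open>The cell set \<open>Y\<close> is arbitrary, because the recursion over the letters works cell by
  cell and does not see whether \<open>Y\<close> is a Young diagram.\<close>

definition flagged :: "(nat \<times> nat) set \<Rightarrow> nat list \<Rightarrow> (nat \<times> nat \<Rightarrow> nat) set" where
  "flagged Y lam = {T \<in> Y \<rightarrow>\<^sub>E {1..length lam}.
     (\<forall>i j j'. (i, j) \<in> Y \<and> (i, j') \<in> Y \<and> j < j' \<longrightarrow> T (i, j) \<le> T (i, j')) \<and>
     (\<forall>i i' j. (i, j) \<in> Y \<and> (i', j) \<in> Y \<and> i < i' \<longrightarrow> T (i, j) < T (i', j)) \<and>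
     (\<forall>i j. (i, j) \<in> Y \<longrightarrow> j \<le> part lam (length lam + 1 - T (i, j)))}"

text \<open>What can be left of \<open>Y\<close> when all cells with the largest letter are removed. The last
  clause says at once that two removed cells never share a column and that the remaining set is
  closed upwards.\<close>

definition peelings :: "(nat \<times> nat) set \<Rightarrow> (nat \<times> nat) set set" where
  "peelings Y = {Z. Z \<subseteq> Y \<and>
     (\<forall>i j j'. (i, j) \<in> Y \<and> (i, j') \<in> Z \<and> j < j' \<longrightarrow> (i, j) \<in> Z) \<and>
     (\<forall>i i' j. (i, j) \<in> Y \<and> (i', j) \<in> Y \<and> i < i' \<longrightarrow> (i, j) \<in> Z)}"

lemma part_Cons_Suc: "1 \<le> i \<Longrightarrow> part (l # lam) (Suc i) = part lam i"
  by (auto simp: part_def nth_Cons split: nat.splits)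

lemma part_Cons_1: "part (l # lam) (Suc 0) = l"
  by (simp add: part_def)

lemma part_antimono:
  assumes "sorted_wrt (\<ge>) lam" "1 \<le> i" "i \<le> k"
  shows "part lam k \<le> part lam i"
  using assms sorted_wrt_nth_less[OF assms(1), of "i - 1" "k - 1"]
  by (cases "i = k") (auto simp: part_def)

lemma finite_flagged: "finite Y \<Longrightarrow> finite (flagged Y lam)"
  unfolding flagged_def by (rule finite_subset[of _ "Y \<rightarrow>\<^sub>E {1..length lam}"])
    (auto intro: finite_PiE)

lemma flagged_empty: "flagged {} lam = {\<lambda>_. undefined}"
  by (auto simp: flagged_def)

lemma flagged_wide_cell:
  assumes "sorted_wrt (\<ge>) lam" "(i, j) \<in> Y" "part lam 1 < j"
  shows "flagged Y lam = {}"
proof -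
  have False if T: "T \<in> flagged Y lam" for T
  proof -
    have "T (i, j) \<in> {1..length lam}" "j \<le> part lam (length lam + 1 - T (i, j))"
      using T assms(2) by (auto simp: flagged_def)
    then show False
      using part_antimono[OF assms(1), of 1 "length lam + 1 - T (i, j)"] assms(3) by simp linarith
  qed
  then show ?thesis by blast
qed

text \<open>Strict columns force \<open>T (i, j) \<ge> i\<close>, which is impossible below row \<open>length lam\<close>.\<close>

lemma flagged_tall_cell:
  assumes "\<And>i j. (Suc i, j) \<in> Y \<Longrightarrow> 1 \<le> i \<Longrightarrow> (i, j) \<in> Y"
    and "(i, j) \<in> Y" "length lam < i"
  shows "flagged Y lam = {}"
proof -
  have False if T: "T \<in> flagged Y lam" for T
  proof -
    have "k \<le> T (k, j)" if "(k, j) \<in> Y" for k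
      using that
    proof (induction k)
      case (Suc k)
      show ?case
      proof (cases "k = 0")
        case True
        then show ?thesis using T Suc.prems by (fastforce simp: flagged_def PiE_iff)
      next
        case False
        then have "(k, j) \<in> Y" using assms(1) Suc.prems by simp
        moreover from this have "T (k, j) < T (Suc k, j)"
          using T Suc.prems unfolding flagged_def by blast
        ultimately show ?thesis using Suc.IH by simp
      qed
    qed simp
    from this[OF assms(2)] show False using T assms(2,3) by (fastforce simp: flagged_def PiE_iff)
  qed
  then show ?thesis by blast
qed

text \<open>A tableau corresponds to the set \<open>Z\<close> of cells with letters up to \<open>length lam\<close> together
  with its restriction to \<open>Z\<close>; the inverse fills \<open>Y - Z\<close> with the letter \<open>length lam + 1\<close>, whose
  flag is \<open>l\<close>. The flags of the smaller letters are unchanged, because an entry \<open>t\<close> is bounded by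
  the part with index \<open>d + 1 - t\<close>, and \<open>d\<close> drops by 1 as the first part is removed.\<close>

lemma card_flagged_Cons:
  assumes fin: "finite Y" and narrow: "\<And>i j. (i, j) \<in> Y \<Longrightarrow> j \<le> l"
  shows "card (flagged Y (l # lam)) = (\<Sum>Z\<in>peelings Y. card (flagged Z lam))"
proof -
  let ?d = "length lam"
  let ?small = "\<lambda>T. {u \<in> Y. T u \<le> ?d}"
  let ?fill = "\<lambda>Z T u. if u \<in> Z then T u else if u \<in> Y then Suc ?d else undefined"
  have finP: "finite (peelings Y)"
    by (rule finite_subset[of _ "Pow Y"]) (use fin in \<open>auto simp: peelings_def\<close>)
  have part_eq: "part (l # lam) (Suc ?d + 1 - t) = part lam (?d + 1 - t)" if "t \<le> ?d" for t
    using part_Cons_Suc[of "?d + 1 - t"] that by (simp add: Suc_diff_le)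
  have "bij_betw (\<lambda>T. (?small T, restrict T (?small T))) (flagged Y (l # lam))
      (Sigma (peelings Y) (\<lambda>Z. flagged Z lam))"
  proof (rule bij_betwI[where g = "\<lambda>(Z, T). ?fill Z T"])
    show "(\<lambda>T. (?small T, restrict T (?small T))) \<in>
        flagged Y (l # lam) \<rightarrow> Sigma (peelings Y) (\<lambda>Z. flagged Z lam)"
    proof
      fix T assume T: "T \<in> flagged Y (l # lam)"
      have range: "1 \<le> T u \<and> T u \<le> Suc ?d" if "u \<in> Y" for u
        using T that by (auto simp: flagged_def PiE_iff)
      have row: "T (i, j) \<le> T (i, j')" if "(i, j) \<in> Y" "(i, j') \<in> Y" "j < j'" for i j j'
        using T that unfolding flagged_def by blast
      have col: "T (i, j) < T (i', j)" if "(i, j) \<in> Y" "(i', j) \<in> Y" "i < i'" for i i' j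
        using T that unfolding flagged_def by blast
      have flag: "j \<le> part (l # lam) (Suc ?d + 1 - T (i, j))" if "(i, j) \<in> Y" for i j
        using T that unfolding flagged_def by simp
      have flag': "j \<le> part lam (Suc ?d - T (i, j))" if "(i, j) \<in> Y" "T (i, j) \<le> ?d" for i j
        using flag[OF that(1)] part_eq[OF that(2)] by simp
      have "?small T \<in> peelings Y"
        unfolding peelings_def
      proof (rule CollectI, intro conjI allI impI)
        fix i j j' assume "(i, j) \<in> Y \<and> (i, j') \<in> ?small T \<and> j < j'"
        then show "(i, j) \<in> ?small T" using row[of i j j'] by auto
      next
        fix i i' j assume "(i, j) \<in> Y \<and> (i', j) \<in> Y \<and> i < i'"
        then show "(i, j) \<in> ?small T" using col[of i j i'] range[of "(i', j)"] by auto
      qed auto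
      moreover have "restrict T (?small T) \<in> flagged (?small T) lam"
        unfolding flagged_def using range row col flag' by auto
      ultimately show "(?small T, restrict T (?small T)) \<in>
          Sigma (peelings Y) (\<lambda>Z. flagged Z lam)" by simp
    qed
    show "(\<lambda>(Z, T). ?fill Z T) \<in>
        Sigma (peelings Y) (\<lambda>Z. flagged Z lam) \<rightarrow> flagged Y (l # lam)"
    proof clarify
      fix Z T assume Z: "Z \<in> peelings Y" and T: "T \<in> flagged Z lam"
      have sub: "Z \<subseteq> Y" using Z by (simp add: peelings_def)
      have left: "(i, j) \<in> Z" if "(i, j) \<in> Y" "(i, j') \<in> Z" "j < j'" for i j j'
        using Z that unfolding peelings_def by blast
      have above: "(i, j) \<in> Z" if "(i, j) \<in> Y" "(i', j) \<in> Y" "i < i'" for i i' j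
        using Z that unfolding peelings_def by blast
      have range: "1 \<le> T u \<and> T u \<le> ?d" if "u \<in> Z" for u
        using T that by (auto simp: flagged_def PiE_iff)
      have row: "T (i, j) \<le> T (i, j')" if "(i, j) \<in> Z" "(i, j') \<in> Z" "j < j'" for i j j'
        using T that unfolding flagged_def by blast
      have col: "T (i, j) < T (i', j)" if "(i, j) \<in> Z" "(i', j) \<in> Z" "i < i'" for i i' j
        using T that unfolding flagged_def by blast
      have flag: "j \<le> part lam (?d + 1 - T (i, j))" if "(i, j) \<in> Z" for i j
        using T that unfolding flagged_def by simp
      show "?fill Z T \<in> flagged Y (l # lam)"
        unfolding flagged_def
      proof (intro CollectI conjI allI impI)
        show "?fill Z T \<in> Y \<rightarrow>\<^sub>E {1..length (l # lam)}"
          using range sub by (fastforce simp: PiE_iff extensional_def)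
      next
        fix i j j' assume "(i, j) \<in> Y \<and> (i, j') \<in> Y \<and> j < j'"
        then show "?fill Z T (i, j) \<le> ?fill Z T (i, j')"
          using row left range by (auto simp: le_SucI)
      next
        fix i i' j assume *: "(i, j) \<in> Y \<and> (i', j) \<in> Y \<and> i < i'"
        then have "(i, j) \<in> Z" using above by blast
        then show "?fill Z T (i, j) < ?fill Z T (i', j)"
          using col range * by (auto simp: le_imp_less_Suc)
      next
        fix i j assume "(i, j) \<in> Y"
        then show "j \<le> part (l # lam) (length (l # lam) + 1 - ?fill Z T (i, j))"
          using narrow flag range part_eq by (auto simp: part_Cons_1)
      qed
    qed
    show "(\<lambda>(Z, T). ?fill Z T) (?small T, restrict T (?small T)) = T"
      if "T \<in> flagged Y (l # lam)" for T
    proof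
      fix u
      have ext: "T \<in> Y \<rightarrow>\<^sub>E {1..Suc ?d}" using that by (simp add: flagged_def)
      show "(\<lambda>(Z, T). ?fill Z T) (?small T, restrict T (?small T)) u = T u"
        using PiE_mem[OF ext, of u] PiE_arb[OF ext, of u] by (cases "u \<in> Y") auto
    qed
    show "(\<lambda>T. (?small T, restrict T (?small T))) ((\<lambda>(Z, T). ?fill Z T) ZT) = ZT"
      if ZT_in: "ZT \<in> Sigma (peelings Y) (\<lambda>Z. flagged Z lam)" for ZT
    proof -
      obtain Z T where ZT: "ZT = (Z, T)" and Z: "Z \<subseteq> Y" and T: "T \<in> Z \<rightarrow>\<^sub>E {1..?d}"
        using ZT_in by (auto simp: peelings_def flagged_def)
      have "?small (?fill Z T) = Z" using Z T by (auto simp: PiE_iff)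
      moreover have "restrict (?fill Z T) Z = T" using T by (auto simp: PiE_iff extensional_def)
      ultimately show ?thesis by (simp add: ZT)
    qed
  qed
  then have "card (flagged Y (l # lam)) = card (Sigma (peelings Y) (\<lambda>Z. flagged Z lam))"
    by (rule bij_betw_same_card)
  also have "\<dots> = (\<Sum>Z\<in>peelings Y. card (flagged Z lam))"
    by (rule card_SigmaI[OF finP])
       (use fin in \<open>auto simp: peelings_def intro!: finite_flagged finite_subset[of _ Y]\<close>)
  finally show ?thesis .
qed

section \<open>Horizontal strips by rows and by columns\<close>

definition row_diagram :: "nat \<Rightarrow> (nat \<Rightarrow> nat) \<Rightarrow> (nat \<times> nat) set" where
  "row_diagram d a = {(i, j). 1 \<le> i \<and> i \<le> d \<and> 1 \<le> j \<and> j \<le> a i}"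

text \<open>Column lengths are integers, because shortening an empty column gives length \<open>-1\<close> in the
  expansion of the second determinant.\<close>

definition col_diagram :: "nat \<Rightarrow> (nat \<Rightarrow> int) \<Rightarrow> (nat \<times> nat) set" where
  "col_diagram n c = {(i, j). 1 \<le> j \<and> j \<le> n \<and> 1 \<le> i \<and> int i \<le> c j}"

definition decreasing_upto :: "nat \<Rightarrow> (nat \<Rightarrow> 'a::linorder) \<Rightarrow> bool" where
  "decreasing_upto n a \<longleftrightarrow> (\<forall>i. 1 \<le> i \<and> i < n \<longrightarrow> a (Suc i) \<le> a i)"

lemma decreasing_uptoD:
  assumes "decreasing_upto n a" "1 \<le> i" "i \<le> k" "k \<le> n"
  shows "a k \<le> a i"
  using assms(3,4)
proof (induction k rule: dec_induct)
  case (step k)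
  then have "a (Suc k) \<le> a k" using assms(1,2) by (simp add: decreasing_upto_def)
  then show ?case using step by simp
qed simp

lemma finite_row_diagram: "finite (row_diagram d a)"
proof -
  have "row_diagram d a = Sigma {1..d} (\<lambda>i. {1..a i})" by (auto simp: row_diagram_def)
  then show ?thesis by simp
qed

lemma finite_col_diagram: "finite (col_diagram n c)"
proof -
  have "col_diagram n c = (\<lambda>(j, i). (i, j)) ` Sigma {1..n} (\<lambda>j. {1..nat (c j)})"
    by (force simp: col_diagram_def image_iff le_nat_iff)
  then show ?thesis by simp
qed

lemma initial_segment_of_nat:
  fixes S :: "nat set"
  assumes "finite S" "\<And>k. k \<in> S \<Longrightarrow> 1 \<le> k" "\<And>k l. l \<in> S \<Longrightarrow> 1 \<le> k \<Longrightarrow> k < l \<Longrightarrow> k \<in> S"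
  shows "S = {1..card S}"
proof (cases "S = {}")
  case False
  have "S = {1..Max S}"
  proof (intro equalityI subsetI)
    fix k assume "k \<in> S"
    then show "k \<in> {1..Max S}" using assms(2) Max_ge[OF assms(1)] by simp
  next
    fix k assume "k \<in> {1..Max S}"
    then show "k \<in> S" using assms(3)[of "Max S" k] Max_in[OF assms(1) False]
      by (cases "k = Max S") auto
  qed
  then show ?thesis by (metis card_atLeastAtMost diff_Suc_1)
qed simp

lemma initial_segment_subset: "{1..m} \<subseteq> {1..n::nat} \<longleftrightarrow> m \<le> n"
  by auto

text \<open>Row \<open>i\<close> keeps at least \<open>a (Suc i)\<close> cells, since a removed cell has no cell of the shape
  below it. Sets with a cell in row \<open>d + 1\<close> are left out, as they carry no tableau with \<open>d\<close>
  letters.\<close>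

lemma bij_betw_interlacing_peelings:
  assumes dec: "decreasing_upto (Suc d) a"
  shows "bij_betw (row_diagram d) (Pi\<^sub>E {1..d} (\<lambda>i. {a (Suc i)..a i}))
    {Z \<in> peelings (row_diagram (Suc d) a). \<forall>(i, j)\<in>Z. i \<le> d}"
  unfolding bij_betw_def
proof
  let ?Y = "row_diagram (Suc d) a"
  have dec': "a k \<le> a i" if "1 \<le> i" "i \<le> k" "k \<le> Suc d" for i k
    using decreasing_uptoD[OF dec that] .
  show "inj_on (row_diagram d) (Pi\<^sub>E {1..d} (\<lambda>i. {a (Suc i)..a i}))"
  proof (rule inj_onI)
    fix v w assume v: "v \<in> Pi\<^sub>E {1..d} (\<lambda>i. {a (Suc i)..a i})"
      and w: "w \<in> Pi\<^sub>E {1..d} (\<lambda>i. {a (Suc i)..a i})" and eq: "row_diagram d v = row_diagram d w"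
    show "v = w"
    proof (rule PiE_ext[OF v w])
      fix i assume "i \<in> {1..d}"
      then have "{1..u i} = {j. (i, j) \<in> row_diagram d u}" for u
        by (auto simp: row_diagram_def)
      then have "card {1..v i} = card {1..w i}" using eq by presburger
      then show "v i = w i" by simp
    qed
  qed
  show "row_diagram d ` Pi\<^sub>E {1..d} (\<lambda>i. {a (Suc i)..a i}) =
      {Z \<in> peelings ?Y. \<forall>(i, j)\<in>Z. i \<le> d}"
  proof (intro equalityI subsetI)
    fix Z assume "Z \<in> row_diagram d ` Pi\<^sub>E {1..d} (\<lambda>i. {a (Suc i)..a i})"
    then obtain v where Z: "Z = row_diagram d v" and "\<And>i. 1 \<le> i \<Longrightarrow> i \<le> d \<Longrightarrow> v i \<in> {a (Suc i)..a i}"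
      by (auto simp: PiE_iff)
    then have v: "a (Suc i) \<le> v i" "v i \<le> a i" if "1 \<le> i" "i \<le> d" for i
      using that by auto
    have "(i, j) \<in> Z" if "(i, j) \<in> ?Y" "(i', j) \<in> ?Y" "i < i'" for i i' j
      using that v(1)[of i] dec'[of "Suc i" i'] by (auto simp: Z row_diagram_def)
    moreover have "Z \<subseteq> ?Y" using v(2) by (fastforce simp: Z row_diagram_def)
    moreover have "(i, j) \<in> Z" if "(i, j) \<in> ?Y" "(i, j') \<in> Z" "j < j'" for i j j'
      using that by (auto simp: Z row_diagram_def)
    ultimately show "Z \<in> {Z \<in> peelings ?Y. \<forall>(i, j)\<in>Z. i \<le> d}"
      unfolding peelings_def by (auto simp: Z row_diagram_def)
  next
    fix Z assume "Z \<in> {Z \<in> peelings ?Y. \<forall>(i, j)\<in>Z. i \<le> d}"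
    then have Z: "Z \<in> peelings ?Y" and short: "\<And>i j. (i, j) \<in> Z \<Longrightarrow> i \<le> d" by auto
    have sub: "Z \<subseteq> ?Y" using Z by (simp add: peelings_def)
    have left: "(i, j) \<in> Z" if "(i, j) \<in> ?Y" "(i, j') \<in> Z" "j < j'" for i j j'
      using Z that unfolding peelings_def by blast
    have above: "(i, j) \<in> Z" if "(i, j) \<in> ?Y" "(i', j) \<in> ?Y" "i < i'" for i i' j
      using Z that unfolding peelings_def by blast
    define v where "v = (\<lambda>i\<in>{1..d}. card {j. (i, j) \<in> Z})"
    have row: "{j. (i, j) \<in> Z} = {1..v i}" if "i \<in> {1..d}" for i
    proof -
      have "{j. (i, j) \<in> Z} = {1..card {j. (i, j) \<in> Z}}"
      proof (rule initial_segment_of_nat)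
        show "finite {j. (i, j) \<in> Z}"
          by (rule finite_subset[of _ "{..a i}"]) (use sub in \<open>auto simp: row_diagram_def\<close>)
        show "1 \<le> j" if "j \<in> {j. (i, j) \<in> Z}" for j
          using that sub by (auto simp: row_diagram_def)
        show "k \<in> {j. (i, j) \<in> Z}" if "j \<in> {j. (i, j) \<in> Z}" "1 \<le> k" "k < j" for j k
          using that sub left[of i k j] by (auto simp: row_diagram_def)
      qed
      then show ?thesis using that by (simp add: v_def)
    qed
    have "a (Suc i) \<le> v i \<and> v i \<le> a i" if i: "i \<in> {1..d}" for i
    proof -
      have "{j. (i, j) \<in> Z} \<subseteq> {1..a i}" using sub by (auto simp: row_diagram_def)
      then have "v i \<le> a i" by (simp only: row[OF i] initial_segment_subset)
      moreover have "{1..a (Suc i)} \<subseteq> {j. (i, j) \<in> Z}"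
        using i above[of i _ "Suc i"] dec'[of i "Suc i"] by (auto simp: row_diagram_def)
      then have "a (Suc i) \<le> v i" by (simp only: row[OF i] initial_segment_subset)
      ultimately show ?thesis by simp
    qed
    then have "v \<in> Pi\<^sub>E {1..d} (\<lambda>i. {a (Suc i)..a i})" by (auto simp: v_def PiE_iff)
    moreover have "row_diagram d v = Z"
    proof (intro equalityI subsetI)
      fix u assume "u \<in> row_diagram d v"
      then obtain i j where u: "u = (i, j)" "i \<in> {1..d}" "j \<in> {1..v i}" by (auto simp: row_diagram_def)
      then show "u \<in> Z" using row by blast
    next
      fix u assume "u \<in> Z"
      moreover obtain i j where u: "u = (i, j)" by (cases u)
      ultimately have "i \<in> {1..d}" using sub short by (auto simp: row_diagram_def)
      moreover from this have "j \<in> {1..v i}" using row \<open>u \<in> Z\<close> u by blast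
      ultimately show "u \<in> row_diagram d v" by (simp add: u row_diagram_def)
    qed
    ultimately show "Z \<in> row_diagram d ` Pi\<^sub>E {1..d} (\<lambda>i. {a (Suc i)..a i})" by blast
  qed
qed

definition partition_like :: "nat \<Rightarrow> (nat \<Rightarrow> int) \<Rightarrow> bool" where
  "partition_like n c \<longleftrightarrow> decreasing_upto n c \<and> (\<forall>j. 1 \<le> j \<and> j \<le> n \<longrightarrow> 0 \<le> c j)"

text \<open>A column loses at most its lowest cell, and closure to the left says that the remaining
  lengths still decrease.\<close>

lemma bij_betw_shortened_columns_peelings:
  assumes pl: "partition_like n c"
  shows "bij_betw (col_diagram n)
    {v \<in> Pi\<^sub>E {1..n} (\<lambda>j. {c j - 1..c j}). partition_like n v} (peelings (col_diagram n c))"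
  unfolding bij_betw_def
proof
  let ?Y = "col_diagram n c"
  let ?V = "{v \<in> Pi\<^sub>E {1..n} (\<lambda>j. {c j - 1..c j}). partition_like n v}"
  have dec: "c k \<le> c i" if "1 \<le> i" "i \<le> k" "k \<le> n" for i k
    using decreasing_uptoD[of n c i k] pl that by (simp add: partition_like_def)
  show "inj_on (col_diagram n) ?V"
  proof (rule inj_onI)
    fix v w assume v: "v \<in> ?V" and w: "w \<in> ?V" and eq: "col_diagram n v = col_diagram n w"
    have vE: "v \<in> Pi\<^sub>E {1..n} (\<lambda>j. {c j - 1..c j})" and wE: "w \<in> Pi\<^sub>E {1..n} (\<lambda>j. {c j - 1..c j})"
      using v w by simp_all
    show "v = w"
    proof (rule PiE_ext[OF vE wE])
      fix j assume j: "j \<in> {1..n}"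
      have "{1..nat (u j)} = {i. (i, j) \<in> col_diagram n u}" for u
        using j by (auto simp: col_diagram_def le_nat_iff)
      then have "card {1..nat (v j)} = card {1..nat (w j)}" using eq by presburger
      moreover have "0 \<le> v j" "0 \<le> w j" using v w j by (simp_all add: partition_like_def)
      ultimately show "v j = w j" by simp
    qed
  qed
  show "col_diagram n ` ?V = peelings ?Y"
  proof (intro equalityI subsetI)
    fix Z assume "Z \<in> col_diagram n ` ?V"
    then obtain v where Z: "Z = col_diagram n v" and pv: "partition_like n v"
      and "\<And>j. 1 \<le> j \<Longrightarrow> j \<le> n \<Longrightarrow> v j \<in> {c j - 1..c j}"
      by (auto simp: PiE_iff)
    then have v: "c j - 1 \<le> v j" "v j \<le> c j" if "1 \<le> j" "j \<le> n" for j
      using that by auto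
    have "(i, j) \<in> Z" if "(i, j) \<in> ?Y" "(i', j) \<in> ?Y" "i < i'" for i i' j
      using that v(1)[of j] by (auto simp: Z col_diagram_def)
    moreover have "Z \<subseteq> ?Y" using v(2) by (fastforce simp: Z col_diagram_def)
    moreover have "(i, j) \<in> Z" if "(i, j) \<in> ?Y" "(i, j') \<in> Z" "j < j'" for i j j'
      using that decreasing_uptoD[of n v j j'] pv
      by (auto simp: Z col_diagram_def partition_like_def)
    ultimately show "Z \<in> peelings ?Y" unfolding peelings_def by blast
  next
    fix Z assume Z: "Z \<in> peelings ?Y"
    have sub: "Z \<subseteq> ?Y" using Z by (simp add: peelings_def)
    have left: "(i, j) \<in> Z" if "(i, j) \<in> ?Y" "(i, j') \<in> Z" "j < j'" for i j j'
      using Z that unfolding peelings_def by blast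
    have above: "(i, j) \<in> Z" if "(i, j) \<in> ?Y" "(i', j) \<in> ?Y" "i < i'" for i i' j
      using Z that unfolding peelings_def by blast
    define v where "v = (\<lambda>j\<in>{1..n}. int (card {i. (i, j) \<in> Z}))"
    have col: "{i. (i, j) \<in> Z} = {1..nat (v j)}" if j: "j \<in> {1..n}" for j
    proof -
      have "{i. (i, j) \<in> Z} = {1..card {i. (i, j) \<in> Z}}"
      proof (rule initial_segment_of_nat)
        show "finite {i. (i, j) \<in> Z}"
          by (rule finite_subset[of _ "{..nat (c j)}"])
             (use sub in \<open>auto simp: col_diagram_def le_nat_iff\<close>)
        show "1 \<le> i" if "i \<in> {i. (i, j) \<in> Z}" for i
          using that sub by (auto simp: col_diagram_def)
        show "k \<in> {i. (i, j) \<in> Z}" if "i \<in> {i. (i, j) \<in> Z}" "1 \<le> k" "k < i" for i k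
          using that sub above[of k j i] by (auto simp: col_diagram_def)
      qed
      then show ?thesis using that by (simp add: v_def)
    qed
    have nonneg: "0 \<le> v j" if "j \<in> {1..n}" for j using that by (simp add: v_def)
    have bounds: "c j - 1 \<le> v j \<and> v j \<le> c j" if j: "j \<in> {1..n}" for j
    proof -
      have "{i. (i, j) \<in> Z} \<subseteq> {1..nat (c j)}"
        using sub by (auto simp: col_diagram_def le_nat_iff)
      then have "nat (v j) \<le> nat (c j)" by (simp only: col[OF j] initial_segment_subset)
      moreover have "{1..nat (c j - 1)} \<subseteq> {i. (i, j) \<in> Z}"
        using j above[of _ j "nat (c j)"] by (auto simp: col_diagram_def le_nat_iff)
      then have "nat (c j - 1) \<le> nat (v j)" by (simp only: col[OF j] initial_segment_subset)
      moreover have "0 \<le> c j" using pl j by (simp add: partition_like_def)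
      ultimately show ?thesis using nonneg[OF j] by linarith
    qed
    have "v (Suc j) \<le> v j" if j: "1 \<le> j" "j < n" for j
    proof -
      have "{i. (i, Suc j) \<in> Z} \<subseteq> {i. (i, j) \<in> Z}"
        using j sub left[of _ j "Suc j"] dec[of j "Suc j"] by (fastforce simp: col_diagram_def)
      moreover have "{i. (i, j) \<in> Z} = {1..nat (v j)}"
        and "{i. (i, Suc j) \<in> Z} = {1..nat (v (Suc j))}"
        using col[of j] col[of "Suc j"] j by simp_all
      ultimately have "nat (v (Suc j)) \<le> nat (v j)" by (simp only: initial_segment_subset)
      then show ?thesis using nonneg[of j] j by simp
    qed
    then have "v \<in> ?V" using bounds nonneg
      by (auto simp: v_def PiE_iff partition_like_def decreasing_upto_def)
    moreover have "col_diagram n v = Z"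
    proof (intro equalityI subsetI)
      fix u assume "u \<in> col_diagram n v"
      then obtain i j where u: "u = (i, j)" "j \<in> {1..n}" "i \<in> {1..nat (v j)}"
        by (auto simp: col_diagram_def le_nat_iff)
      then show "u \<in> Z" using col by blast
    next
      fix u assume "u \<in> Z"
      moreover obtain i j where u: "u = (i, j)" by (cases u)
      ultimately have j: "j \<in> {1..n}" using sub by (auto simp: col_diagram_def)
      then have "i \<in> {1..nat (v j)}" using col \<open>u \<in> Z\<close> u by blast
      then show "u \<in> col_diagram n v" using j by (auto simp: u col_diagram_def le_nat_iff)
    qed
    ultimately show "Z \<in> col_diagram n ` ?V" by blast
  qed
qed

section \<open>The determinant from row lengths\<close>

text \<open>The induction needs every weakly decreasing \<open>a\<close>, not only shapes inside the diagram of
  \<open>lam\<close>: a strip may leave a first row longer than the next part of \<open>lam\<close>. For such shapes both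
  sides vanish, the determinant because its first column is zero.\<close>

theorem card_flagged_row_diagram:
  assumes "sorted_wrt (\<ge>) lam" "decreasing_upto (length lam) a"
  shows "int (card (flagged (row_diagram (length lam) a) lam)) =
    det (mat1 (length lam)
      (\<lambda>i j. ibinom (int (part lam i) - int (a j) + int j - 1) (int i - 1)))"
  using assms
proof (induction lam arbitrary: a)
  case Nil
  have "row_diagram 0 a = {}" by (auto simp: row_diagram_def)
  then show ?case by (simp add: flagged_empty det_dim_zero[OF mat1_carrier])
next
  case (Cons l lam)
  let ?d = "length lam"
  let ?Y = "row_diagram (Suc ?d) a"
  let ?M = "\<lambda>i j. ibinom (int (part (l # lam) i) - int (a j) + int j - 1) (int i - 1)"
  let ?S = "\<lambda>j. {a (Suc j)..a j}"
  have dec: "a k \<le> a i" if "1 \<le> i" "i \<le> k" "k \<le> Suc ?d" for i k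
    using decreasing_uptoD[of "Suc ?d" a i k] Cons.prems(2) that by simp
  have sorted: "sorted_wrt (\<ge>) lam" using Cons.prems(1) by simp
  show ?case
  proof (cases "a 1 \<le> l")
    case False
    have "part (l # lam) i \<le> l" if "1 \<le> i" for i
      using part_antimono[OF Cons.prems(1), of 1 i] that by (simp add: part_Cons_1)
    then have "det (mat1 (Suc ?d) ?M) = 0"
      using False by (intro det_mat1_zero_column[of 1]) (fastforce simp: ibinom_def)+
    moreover have "flagged ?Y (l # lam) = {}"
      by (rule flagged_wide_cell[OF Cons.prems(1), of 1 "a 1"])
         (use False in \<open>auto simp: row_diagram_def part_Cons_1\<close>)
    ultimately show ?thesis by simp
  next
    case True
    have cells_above: "(i, j) \<in> ?Y" if "(i', j) \<in> ?Y" "1 \<le> i" "i \<le> i'" for i i' j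
      using that dec[of i i'] by (auto simp: row_diagram_def)
    have "card (flagged ?Y (l # lam)) = (\<Sum>Z\<in>peelings ?Y. card (flagged Z lam))"
    proof (rule card_flagged_Cons[OF finite_row_diagram])
      show "j \<le> l" if "(i, j) \<in> ?Y" for i j
        using that True dec[of 1 i] by (auto simp: row_diagram_def)
    qed
    also have "\<dots> =
        (\<Sum>Z | Z \<in> peelings ?Y \<and> (\<forall>(i, j)\<in>Z. i \<le> ?d). card (flagged Z lam))"
    proof (rule sum.mono_neutral_right)
      show "finite (peelings ?Y)"
        by (rule finite_subset[of _ "Pow ?Y"]) (auto simp: peelings_def finite_row_diagram)
      show "\<forall>Z\<in>peelings ?Y - {Z \<in> peelings ?Y. \<forall>(i, j)\<in>Z. i \<le> ?d}. card (flagged Z lam) = 0"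
      proof
        fix Z assume "Z \<in> peelings ?Y - {Z \<in> peelings ?Y. \<forall>(i, j)\<in>Z. i \<le> ?d}"
        then obtain i j where Z: "Z \<in> peelings ?Y" and ij: "(i, j) \<in> Z" "?d < i"
          by (auto simp: not_le)
        have "(k, j') \<in> Z" if "(Suc k, j') \<in> Z" "1 \<le> k" for k j'
        proof -
          have "(Suc k, j') \<in> ?Y" using Z that by (auto simp: peelings_def)
          then show ?thesis
            using Z cells_above[of "Suc k" j' k] that(2) unfolding peelings_def by force
        qed
        then show "card (flagged Z lam) = 0" using flagged_tall_cell[of Z i j lam] ij by simp
      qed
    qed auto
    also have "\<dots> = (\<Sum>v\<in>Pi\<^sub>E {1..?d} ?S. card (flagged (row_diagram ?d v) lam))"
      using sum.reindex_bij_betw[OF bij_betw_interlacing_peelings[of ?d a],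
          of "\<lambda>Z. card (flagged Z lam)"] Cons.prems(2)
      by simp
    finally have "int (card (flagged ?Y (l # lam))) =
        (\<Sum>v\<in>Pi\<^sub>E {1..?d} ?S. int (card (flagged (row_diagram ?d v) lam)))" by simp
    also have "\<dots> = (\<Sum>v\<in>Pi\<^sub>E {1..?d} ?S. det (mat1 ?d
        (\<lambda>i j. ibinom (int (part lam i) - int (v j) + int j - 1) (int i - 1))))"
    proof (rule sum.cong[OF refl])
      fix v assume "v \<in> Pi\<^sub>E {1..?d} ?S"
      then have v: "v i \<in> ?S i" if "1 \<le> i" "i \<le> ?d" for i using that by (auto simp: PiE_iff)
      have "decreasing_upto ?d v"
        unfolding decreasing_upto_def
      proof (intro allI impI)
        fix i assume "1 \<le> i \<and> i < ?d"
        then show "v (Suc i) \<le> v i" using v[of i] v[of "Suc i"] by auto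
      qed
      then show "int (card (flagged (row_diagram ?d v) lam)) = det (mat1 ?d
          (\<lambda>i j. ibinom (int (part lam i) - int (v j) + int j - 1) (int i - 1)))"
        by (rule Cons.IH[OF sorted])
    qed
    also have "\<dots> = det (mat1 ?d
        (\<lambda>i j. \<Sum>v\<in>?S j. ibinom (int (part lam i) - int v + int j - 1) (int i - 1)))"
      by (rule det_mat1_column_sums[symmetric]) simp
    also have "mat1 ?d
        (\<lambda>i j. \<Sum>v\<in>?S j. ibinom (int (part lam i) - int v + int j - 1) (int i - 1)) =
        mat1 ?d (\<lambda>i j. ?M (i + 1) (j + 1) - ?M (i + 1) j)"
    proof (rule mat1_cong)
      fix i j assume ij: "1 \<le> i" "i \<le> ?d" "1 \<le> j" "j \<le> ?d"
      show "(\<Sum>v\<in>?S j. ibinom (int (part lam i) - int v + int j - 1) (int i - 1)) =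
          ?M (i + 1) (j + 1) - ?M (i + 1) j"
        using ibinom_difference[of "int i" "a (Suc j)" "a j" "int (part lam i) + int j"]
          dec[of j "Suc j"] ij
        by (simp add: part_Cons_Suc algebra_simps)
    qed
    also have "det \<dots> = det (mat1 (Suc ?d) ?M)"
    proof (rule det_mat1_column_differences[symmetric])
      fix j assume "1 \<le> j" "j \<le> Suc ?d"
      then have "a j \<le> l" using dec[of 1 j] True by simp
      then show "?M 1 j = 1" using \<open>1 \<le> j\<close> by (simp add: ibinom_def part_Cons_1)
    qed
    finally show ?thesis by simp
  qed
qed

section \<open>The determinant from column lengths\<close>

lemma conj_part_Nil: "conj_part [] j = 0"
  by (simp add: conj_part_def young_diagram_def)

lemma finite_young_diagram_column: "finite {i. (i, j) \<in> young_diagram lam}"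
  by (rule finite_subset[of _ "{..length lam}"]) (auto simp: young_diagram_def)

lemma conj_part_Cons:
  assumes "sorted_wrt (\<ge>) (l # lam)" "1 \<le> j"
  shows "conj_part (l # lam) j = (if j \<le> l then Suc (conj_part lam j) else 0)"
proof (cases "j \<le> l")
  case True
  let ?C = "{i. (i, j) \<in> young_diagram lam}"
  have "{i. (i, j) \<in> young_diagram (l # lam)} = insert 1 (Suc ` ?C)"
  proof (intro equalityI subsetI)
    fix i assume "i \<in> {i. (i, j) \<in> young_diagram (l # lam)}"
    then show "i \<in> insert 1 (Suc ` ?C)"
      by (cases i; cases "i = 1") (auto simp: young_diagram_def part_Cons_Suc image_iff)
  qed (use True assms(2) in \<open>auto simp: young_diagram_def part_Cons_Suc part_Cons_1\<close>)
  moreover have "1 \<notin> Suc ` ?C" by (auto simp: young_diagram_def)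
  moreover have "card (Suc ` ?C) = card ?C" by (simp add: card_image)
  ultimately show ?thesis
    using True finite_young_diagram_column[of j lam] by (simp add: conj_part_def)
next
  case False
  have "(i, j) \<notin> young_diagram (l # lam)" for i
    using part_antimono[OF assms(1), of 1 i] False by (auto simp: young_diagram_def part_Cons_1)
  then show ?thesis using False by (simp add: conj_part_def)
qed

lemma conj_part_eq_0:
  assumes "sorted_wrt (\<ge>) lam" "1 \<le> j"
  shows "conj_part lam j = 0 \<longleftrightarrow> part lam 1 < j"
proof (cases lam)
  case Nil
  then show ?thesis using assms(2) by (simp add: conj_part_Nil part_def)
next
  case (Cons l lam')
  then show ?thesis using conj_part_Cons[of l lam' j] assms by (simp add: part_Cons_1)
qed

text \<open>In a column beyond the diagram of \<open>lam\<close> Pascal's rule is not available, since its upper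
  index is already 0. There the last row of the matrix is zero except for its last entry, which is
  1 or 0 according to whether the last column of the shape is empty.\<close>

lemma card_flagged_col_diagram_beyond:
  assumes sorted: "sorted_wrt (\<ge>) lam" and wide: "part lam 1 < Suc n"
    and pl: "partition_like (Suc n) c"
    and IH: "int (card (flagged (col_diagram n c) lam)) =
      det (mat1 n (\<lambda>i j. ibinom (int (conj_part lam i)) (c j + int i - int j)))"
  shows "int (card (flagged (col_diagram (Suc n) c) lam)) =
      det (mat1 (Suc n) (\<lambda>i j. ibinom (int (conj_part lam i)) (c j + int i - int j)))"
proof -
  let ?M = "\<lambda>i j. ibinom (int (conj_part lam i)) (c j + int i - int j)"
  have zero: "conj_part lam (Suc n) = 0" using conj_part_eq_0[OF sorted] wide by simp
  have nonneg: "0 \<le> c j" if "1 \<le> j" "j \<le> Suc n" for j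
    using pl that by (simp add: partition_like_def)
  have "det (mat1 (Suc n) ?M) = ?M (Suc n) (Suc n) * det (mat1 n ?M)"
  proof (rule det_mat1_last_row)
    fix j assume "1 \<le> j" "j \<le> n"
    then show "?M (Suc n) j = 0" using nonneg[of j] by (simp add: zero ibinom_zero_top)
  qed
  also have "?M (Suc n) (Suc n) = (if c (Suc n) = 0 then 1 else 0)"
    by (simp add: zero ibinom_zero_top)
  finally have det: "det (mat1 (Suc n) ?M) = (if c (Suc n) = 0 then det (mat1 n ?M) else 0)"
    by simp
  show ?thesis
  proof (cases "c (Suc n) = 0")
    case True
    then have "col_diagram (Suc n) c = col_diagram n c"
      by (auto simp: col_diagram_def le_Suc_eq)
    then show ?thesis using det IH True by simp
  next
    case False
    then have "(1, Suc n) \<in> col_diagram (Suc n) c"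
      using nonneg[of "Suc n"] by (simp add: col_diagram_def)
    then have "flagged (col_diagram (Suc n) c) lam = {}"
      using flagged_wide_cell[OF sorted] wide by blast
    then show ?thesis using det False by simp
  qed
qed

text \<open>The recursion over partition shapes \<open>v\<close> extends to all choices of \<open>v j\<close> in
  \<open>{c j - 1, c j}\<close>, because the additional determinants vanish. If \<open>v (Suc j) > v j\<close>, then
  \<open>c (Suc j) = c j\<close> and only the first of these two columns of the shape was shortened, which
  makes columns \<open>j\<close> and \<open>Suc j\<close> of the matrix equal; if \<open>v\<close> decreases but becomes negative, then \<open>v n = -1\<close> and column \<open>n\<close> of the
  matrix is zero.\<close>

lemma card_flagged_col_diagram_Cons:
  assumes narrow: "n \<le> l" and sorted: "sorted_wrt (\<ge>) (l # lam)" and pl: "partition_like n c"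
    and IH: "\<And>v. partition_like n v \<Longrightarrow> int (card (flagged (col_diagram n v) lam)) =
      det (mat1 n (\<lambda>i j. ibinom (int (conj_part lam i)) (v j + int i - int j)))"
  shows "int (card (flagged (col_diagram n c) (l # lam))) =
      det (mat1 n (\<lambda>i j. ibinom (int (conj_part (l # lam) i)) (c j + int i - int j)))"
proof -
  let ?Y = "col_diagram n c"
  let ?S = "\<lambda>j. {c j - 1..c j}"
  let ?D = "\<lambda>v. det (mat1 n (\<lambda>i j. ibinom (int (conj_part lam i)) (v j + int i - int j)))"
  have "card (flagged ?Y (l # lam)) = (\<Sum>Z\<in>peelings ?Y. card (flagged Z lam))"
    by (rule card_flagged_Cons[OF finite_col_diagram])
       (use narrow in \<open>auto simp: col_diagram_def\<close>)
  also have "\<dots> = (\<Sum>v | v \<in> Pi\<^sub>E {1..n} ?S \<and> partition_like n v.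
      card (flagged (col_diagram n v) lam))"
    by (rule sum.reindex_bij_betw[OF bij_betw_shortened_columns_peelings[OF pl], symmetric])
  finally have "int (card (flagged ?Y (l # lam))) =
      (\<Sum>v | v \<in> Pi\<^sub>E {1..n} ?S \<and> partition_like n v. ?D v)"
    by (simp add: IH)
  also have "\<dots> = (\<Sum>v\<in>Pi\<^sub>E {1..n} ?S. ?D v)"
  proof (rule sum.mono_neutral_left)
    show "finite (Pi\<^sub>E {1..n} ?S)" by (intro finite_PiE) auto
    show "\<forall>v\<in>Pi\<^sub>E {1..n} ?S - {v \<in> Pi\<^sub>E {1..n} ?S. partition_like n v}. ?D v = 0"
    proof
      fix v assume "v \<in> Pi\<^sub>E {1..n} ?S - {v \<in> Pi\<^sub>E {1..n} ?S. partition_like n v}"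
      then have npl: "\<not> partition_like n v" and v: "\<And>j. 1 \<le> j \<Longrightarrow> j \<le> n \<Longrightarrow> v j \<in> ?S j"
        by (auto simp: PiE_iff)
      show "?D v = 0"
      proof (cases "decreasing_upto n v")
        case False
        then obtain j where j: "1 \<le> j" "j < n" "v j < v (Suc j)"
          by (auto simp: decreasing_upto_def not_le)
        moreover have "c (Suc j) \<le> c j"
          using pl j by (simp add: partition_like_def decreasing_upto_def)
        ultimately have "v (Suc j) = v j + 1" using v[of j] v[of "Suc j"] by simp
        then show ?thesis
          using j by (intro det_mat1_equal_columns[of j "Suc j"]) (auto simp: algebra_simps)
      next
        case True
        then obtain j where j: "1 \<le> j" "j \<le> n" "v j < 0"
          using npl by (auto simp: partition_like_def not_le)
        then have "v n < 0" using decreasing_uptoD[OF True, of j n] by simp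
        then show ?thesis
          using j by (intro det_mat1_zero_column[of n]) (auto simp: ibinom_def)
      qed
    qed
  qed auto
  also have "\<dots> = det (mat1 n
      (\<lambda>i j. \<Sum>v\<in>?S j. ibinom (int (conj_part lam i)) (v + int i - int j)))"
    by (rule det_mat1_column_sums[symmetric]) simp
  also have "mat1 n (\<lambda>i j. \<Sum>v\<in>?S j. ibinom (int (conj_part lam i)) (v + int i - int j)) =
      mat1 n (\<lambda>i j. ibinom (int (conj_part (l # lam) i)) (c j + int i - int j))"
  proof (rule mat1_cong)
    fix i j assume "1 \<le> i" "i \<le> n"
    moreover have "?S j = {c j - 1, c j}" by auto
    ultimately show "(\<Sum>v\<in>?S j. ibinom (int (conj_part lam i)) (v + int i - int j)) =
        ibinom (int (conj_part (l # lam) i)) (c j + int i - int j)"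
      using conj_part_Cons[OF sorted, of i] narrow
        ibinom_pascal[of "int (conj_part lam i)" "c j + int i - int j"]
      by (simp add: algebra_simps)
  qed
  finally show ?thesis .
qed

text \<open>As the induction takes parts off \<open>lam\<close>, the number \<open>n\<close> of columns can come to exceed the
  first part that remains; the inner induction on \<open>n\<close> drops the columns beyond it.\<close>

theorem card_flagged_col_diagram:
  assumes "sorted_wrt (\<ge>) lam" "partition_like n c"
  shows "int (card (flagged (col_diagram n c) lam)) =
    det (mat1 n (\<lambda>i j. ibinom (int (conj_part lam i)) (c j + int i - int j)))"
  using assms
proof (induction lam arbitrary: n c)
  case Nil
  from Nil.prems(2) show ?case
  proof (induction n)
    case 0
    have "col_diagram 0 c = {}" by (auto simp: col_diagram_def)
    then show ?case by (simp add: flagged_empty det_dim_zero[OF mat1_carrier])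
  next
    case (Suc n)
    then have "partition_like n c" by (simp add: partition_like_def decreasing_upto_def)
    then show ?case using Suc by (intro card_flagged_col_diagram_beyond) (auto simp: part_def)
  qed
next
  case (Cons l lam)
  from Cons.prems(2) show ?case
  proof (induction n)
    case 0
    have "col_diagram 0 c = {}" by (auto simp: col_diagram_def)
    then show ?case by (simp add: flagged_empty det_dim_zero[OF mat1_carrier])
  next
    case (Suc n)
    show ?case
    proof (cases "Suc n \<le> l")
      case True
      then show ?thesis
        using Cons.prems(1) Suc.prems Cons.IH by (intro card_flagged_col_diagram_Cons) auto
    next
      case False
      have "partition_like n c" using Suc.prems by (simp add: partition_like_def decreasing_upto_def)
      then show ?thesis using Suc False Cons.prems(1)
        by (intro card_flagged_col_diagram_beyond) (auto simp: part_Cons_1)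
    qed
  qed
qed

section \<open>The nonzero terms of the Okounkov--Olshanski formula\<close>

lemma finite_young_diagram: "finite (young_diagram mu)"
proof -
  have "young_diagram mu = row_diagram (length mu) (part mu)"
    by (auto simp: young_diagram_def row_diagram_def)
  then show ?thesis by (simp add: finite_row_diagram)
qed

lemma young_diagram_above:
  assumes "sorted_wrt (\<ge>) mu" "(i, j) \<in> young_diagram mu" "1 \<le> k" "k \<le> i"
  shows "(k, j) \<in> young_diagram mu"
  using assms part_antimono[of mu k i] by (auto simp: young_diagram_def)

text \<open>Along row 1 of the tableau the numbers \<open>\<lambda>\<^bsub>d+1-T(1,j)\<^esub> - j + 1\<close> start at a positive
  value, since every part of \<open>\<lambda>\<close> is positive, and each step lowers them by at most 1, since \<open>T\<close>
  increases along the row. If none of them vanishes they are therefore all positive, which is the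
  flag condition in row 1. Going down a column \<open>\<lambda>\<^bsub>d+1-T(i,j)\<^esub>\<close> does not decrease, so the
  condition passes from row 1 to all rows. Conversely it makes the factor of a cell in row \<open>i\<close> at
  least \<open>i\<close>, hence positive.\<close>

lemma nonzero_oo_terms:
  assumes lam: "is_partition lam" and mu: "is_partition mu"
  shows "{T \<in> SSYT mu (length lam). oo_term lam mu T \<noteq> 0} = flagged (young_diagram mu) lam"
proof -
  let ?Y = "young_diagram mu"
  let ?d = "length lam"
  have sorted: "sorted_wrt (\<ge>) lam" "sorted_wrt (\<ge>) mu"
    using lam mu by (simp_all add: is_partition_def)
  have "oo_term lam mu T \<noteq> 0 \<longleftrightarrow> (\<forall>i j. (i, j) \<in> ?Y \<longrightarrow> j \<le> part lam (?d + 1 - T (i, j)))"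
    (is "?nonzero \<longleftrightarrow> ?flag")
    if T: "T \<in> SSYT mu ?d" for T
  proof -
    have range: "1 \<le> T u \<and> T u \<le> ?d" if "u \<in> ?Y" for u
      using T that by (auto simp: SSYT_def PiE_iff)
    have row: "T (i, j) \<le> T (i, j')" if "(i, j) \<in> ?Y" "(i, j') \<in> ?Y" "j < j'" for i j j'
      using T that unfolding SSYT_def by blast
    have col: "T (i, j) < T (i', j)" if "(i, j) \<in> ?Y" "(i', j) \<in> ?Y" "i < i'" for i i' j
      using T that unfolding SSYT_def by blast
    have ?flag if ?nonzero
    proof -
      have factor: "int (part lam (?d + 1 - T u)) \<noteq> cell_content u" if "u \<in> ?Y" for u
        using that \<open>?nonzero\<close> finite_young_diagram[of mu] by (simp add: oo_term_def)
      have first: "j \<le> part lam (?d + 1 - T (1, j))" if "(1, j) \<in> ?Y" for j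
        using that
      proof (induction j)
        case (Suc j)
        let ?r = "?d + 1 - T (1, Suc j)"
        have r: "1 \<le> ?r" "?r \<le> ?d" using range[OF Suc.prems] by auto
        have "j \<le> part lam ?r"
        proof (cases "j = 0")
          case False
          then have j: "(1, j) \<in> ?Y" using Suc.prems by (auto simp: young_diagram_def)
          then have "j \<le> part lam (?d + 1 - T (1, j))" by (rule Suc.IH)
          also have "\<dots> \<le> part lam ?r"
            using part_antimono[OF sorted(1), of ?r "?d + 1 - T (1, j)"] r
              row[OF j Suc.prems] by simp
          finally show ?thesis .
        qed simp
        moreover have "part lam ?r \<noteq> j"
          using factor[OF Suc.prems] by (simp add: cell_content_def)
        ultimately show ?case by simp
      qed simp
      show ?flag
      proof (intro allI impI)
        fix i j assume ij: "(i, j) \<in> ?Y"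
        then have i: "1 \<le> i" by (simp add: young_diagram_def)
        then have 1: "(1, j) \<in> ?Y" using young_diagram_above[OF sorted(2) ij] by simp
        have "T (1, j) \<le> T (i, j)" using col[OF 1 ij] i by (cases "i = 1") auto
        then have "part lam (?d + 1 - T (1, j)) \<le> part lam (?d + 1 - T (i, j))"
          using range[OF ij] by (intro part_antimono[OF sorted(1)]) auto
        then show "j \<le> part lam (?d + 1 - T (i, j))" using first[OF 1] by simp
      qed
    qed
    moreover have ?nonzero if ?flag
    proof -
      have "int (part lam (?d + 1 - T u)) - cell_content u \<noteq> 0" if "u \<in> ?Y" for u
      proof -
        obtain i j where u: "u = (i, j)" by (cases u)
        then have "1 \<le> i" "j \<le> part lam (?d + 1 - T u)"
          using that \<open>?flag\<close> by (auto simp: young_diagram_def)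
        then show ?thesis by (simp add: u cell_content_def)
      qed
      then show ?thesis using finite_young_diagram[of mu] by (simp add: oo_term_def)
    qed
    ultimately show ?thesis by blast
  qed
  then show ?thesis by (auto simp: flagged_def SSYT_def)
qed

lemma partition_like_conj_part:
  assumes "sorted_wrt (\<ge>) mu"
  shows "partition_like n (\<lambda>j. int (conj_part mu j))"
proof -
  have "conj_part mu (Suc j) \<le> conj_part mu j" if "1 \<le> j" for j
    unfolding conj_part_def
    by (rule card_mono[OF finite_young_diagram_column])
       (use that in \<open>auto simp: young_diagram_def\<close>)
  then show ?thesis by (simp add: partition_like_def decreasing_upto_def)
qed

lemma young_diagram_eq_col_diagram:
  assumes sorted: "sorted_wrt (\<ge>) mu"
  shows "young_diagram mu = col_diagram (part mu 1) (\<lambda>j. int (conj_part mu j))"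
proof -
  have "{i. (i, j) \<in> young_diagram mu} = {1..conj_part mu j}" for j
    unfolding conj_part_def
  proof (rule initial_segment_of_nat[OF finite_young_diagram_column])
    show "1 \<le> i" if "i \<in> {i. (i, j) \<in> young_diagram mu}" for i
      using that by (simp add: young_diagram_def)
    show "k \<in> {i. (i, j) \<in> young_diagram mu}"
      if "i \<in> {i. (i, j) \<in> young_diagram mu}" "1 \<le> k" "k < i" for i k
      using that young_diagram_above[OF sorted, of i j k] by simp
  qed
  then have column: "(i, j) \<in> young_diagram mu \<longleftrightarrow> 1 \<le> i \<and> i \<le> conj_part mu j" for i j
    by (metis mem_Collect_eq atLeastAtMost_iff)
  have "1 \<le> j \<and> j \<le> part mu 1" if "(i, j) \<in> young_diagram mu" for i j
    using that part_antimono[OF sorted, of 1 i] by (auto simp: young_diagram_def)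
  then show ?thesis using column by (auto simp: col_diagram_def)
qed

theorem theorem1p2:
  fixes lam mu :: "nat list" and d :: nat
  assumes "is_partition lam" and "length lam = d"
    and "is_partition mu"
    and "young_diagram mu \<subseteq> young_diagram lam"
  shows "int (OOT lam mu) =
      det (mat1 d (\<lambda>i j.
        ibinom (int (part lam i) - int (part mu j) + int j - 1) (int i - 1)))
    \<and> int (OOT lam mu) =
      det (mat1 (part mu 1) (\<lambda>i j.
        ibinom (int (conj_part lam i)) (int (conj_part mu j) + int i - int j)))"
proof -
  have sorted: "sorted_wrt (\<ge>) lam" "sorted_wrt (\<ge>) mu"
    using assms(1,3) by (simp_all add: is_partition_def)
  have OOT: "OOT lam mu = card (flagged (young_diagram mu) lam)"
    using nonzero_oo_terms[OF assms(1,3)] by (simp add: OOT_def)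
  have "length mu \<le> d"
  proof (cases "mu = []")
    case False
    then have "part mu (length mu) \<in> set mu" by (simp add: part_def Suc_le_eq)
    then have "1 \<le> part mu (length mu)" using assms(3) by (simp add: is_partition_def)
    then have "(length mu, 1) \<in> young_diagram mu"
      using False by (simp add: young_diagram_def Suc_le_eq)
    then show ?thesis using assms(2,4) by (auto simp: young_diagram_def)
  qed simp
  then have "young_diagram mu = row_diagram d (part mu)"
    by (auto simp: young_diagram_def row_diagram_def part_def split: if_splits)
  moreover have "decreasing_upto d (part mu)"
    by (simp add: decreasing_upto_def part_antimono[OF sorted(2)])
  ultimately have "int (OOT lam mu) =
      det (mat1 d (\<lambda>i j.
        ibinom (int (part lam i) - int (part mu j) + int j - 1) (int i - 1)))"
    using card_flagged_row_diagram[OF sorted(1), of "part mu"] OOT assms(2) by simp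
  moreover have "int (OOT lam mu) =
      det (mat1 (part mu 1) (\<lambda>i j.
        ibinom (int (conj_part lam i)) (int (conj_part mu j) + int i - int j)))"
    unfolding OOT young_diagram_eq_col_diagram[OF sorted(2)]
    by (rule card_flagged_col_diagram[OF sorted(1) partition_like_conj_part[OF sorted(2)]])
  ultimately show ?thesis by blast
qed

end
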